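(* Let $G$ be a finite simple undirected graph of order $n$ with at least one edge and adjacency matrix $A$. Let $k\ge 2$ and let $0<p,q<\infty$ with $\frac1p+\frac1q=1$. Then $$\frac{\left(\phi_j(|A|^k)\right)^{q}}{\left(\phi_j(|A|^{p(k-1)+1})\right)^{q/p}}\le \mathcal{E}_G(v_j)\qquad\text{for all } j=1,\dots,n.$$
   Context: $G$ has vertices $v_1,\dots,v_n$ and adjacency matrix $A$ ($A_{ij}=1$ if $v_i\sim v_j$, else $0$). $|A|=(AA^* )^{1/2}$, and for real $s>0$, $|A|^s$ is defined by functional calculus (i.e. $|A|^s=U\,\mathrm{diag}(|\lambda_1|^s,\dots,|\lambda_n|^s)\,U^t$ where $A=U\,\mathrm{diag}(\lambda_1,\dots,\lambda_n)U^t$ with $U$ orthogonal). For a matrix $M$, $\phi_j(M)=M_{jj}$. The energy of the vertex $v_j$ is $\mathcal{E}_G(v_j)=|A|_{jj}=\phi_j(|A|)$. *)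

theory Defs
  imports "HOL-Analysis.Analysis"
begin

text \<open>A finite simple undirected graph is a symmetric irreflexive adjacency relation on a finite
  vertex type \<open>'n\<close>; its order is \<open>CARD('n)\<close>, and vertices index the matrices directly.\<close>

definition simple_graph :: "('n::finite \<Rightarrow> 'n \<Rightarrow> bool) \<Rightarrow> bool" where
  "simple_graph E \<longleftrightarrow> symp E \<and> irreflp E"

definition adj_matrix :: "('n::finite \<Rightarrow> 'n \<Rightarrow> bool) \<Rightarrow> real^'n^'n" where
  "adj_matrix E = (\<chi> i j. if E i j then 1 else 0)"

definition diag_matrix :: "('n::finite \<Rightarrow> real) \<Rightarrow> real^'n^'n" where
  "diag_matrix d = (\<chi> i j. if i = j then d i else 0)"

definition orth_diagonalises :: "real^'n^'n \<Rightarrow> ('n::finite \<Rightarrow> real) \<Rightarrow> real^'n^'n \<Rightarrow> bool" where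
  "orth_diagonalises U d A \<longleftrightarrow>
     orthogonal_matrix U \<and> A = U ** diag_matrix d ** transpose U"

text \<open>Functional calculus. Intended for symmetric \<open>A\<close> (which have an orthogonal
  diagonalisation by the spectral theorem); \<open>matrix_fun_eq\<close> below shows that the value does not
  depend on the diagonalisation chosen.\<close>

definition matrix_fun :: "(real \<Rightarrow> real) \<Rightarrow> real^'n^'n \<Rightarrow> real^'n::finite^'n" where
  "matrix_fun f A =
     (THE B. \<exists>U d. orth_diagonalises U d A \<and> B = U ** diag_matrix (\<lambda>i. f (d i)) ** transpose U)"

definition matrix_abs :: "real^'n^'n \<Rightarrow> real^'n::finite^'n" where
  "matrix_abs A = matrix_fun sqrt (A ** transpose A)"

text \<open>The power \<open>|A|\<^sup>s\<close> for \<open>s > 0\<close>. Note that \<open>0 powr s = 0\<close>, so zero eigenvalues of \<open>A\<close>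
  contribute zero.\<close>

definition matrix_abs_powr :: "real^'n^'n \<Rightarrow> real \<Rightarrow> real^'n::finite^'n" where
  "matrix_abs_powr A s = matrix_fun (\<lambda>x. \<bar>x\<bar> powr s) A"

definition diag_entry :: "'n::finite \<Rightarrow> real^'n^'n \<Rightarrow> real" where
  "diag_entry j M = M $ j $ j"

definition vertex_energy :: "('n::finite \<Rightarrow> 'n \<Rightarrow> bool) \<Rightarrow> 'n \<Rightarrow> real" where
  "vertex_energy E j = diag_entry j (matrix_abs (adj_matrix E))"

lemma diag_matrix_mult_left: "(diag_matrix d ** M) $ i $ j = d i * M $ i $ j"
  by (simp add: matrix_matrix_mult_def diag_matrix_def if_distrib[of "\<lambda>x. x * _"] cong: if_cong)

lemma diag_matrix_mult_right: "(M ** diag_matrix d) $ i $ j = M $ i $ j * d j"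
  by (simp add: matrix_matrix_mult_def diag_matrix_def if_distrib[of "\<lambda>x. _ * x"] cong: if_cong)

lemma matrix_fun_unique:
  assumes "orth_diagonalises U d A" and "orth_diagonalises V e A"
  shows "U ** diag_matrix (\<lambda>i. f (d i)) ** transpose U
       = V ** diag_matrix (\<lambda>i. f (e i)) ** transpose V"
proof -
  have U: "transpose U ** U = mat 1" "U ** transpose U = mat 1"
    and V: "transpose V ** V = mat 1" "V ** transpose V = mat 1"
    and eq: "U ** diag_matrix d ** transpose U = V ** diag_matrix e ** transpose V"
    using assms by (auto simp: orth_diagonalises_def orthogonal_matrix_def)
  define W where "W = transpose U ** V"
  have "diag_matrix d ** W = transpose U ** (U ** diag_matrix d ** transpose U) ** V"
    unfolding W_def by (simp add: matrix_mul_assoc U)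
  also have "\<dots> = transpose U ** (V ** diag_matrix e ** transpose V) ** V"
    by (simp add: eq)
  also have "\<dots> = W ** diag_matrix e ** (transpose V ** V)"
    unfolding W_def by (simp add: matrix_mul_assoc)
  finally have "diag_matrix d ** W = W ** diag_matrix e" by (simp add: V)
  then have entry: "d i * W $ i $ j = W $ i $ j * e j" for i j
    by (metis diag_matrix_mult_left diag_matrix_mult_right)
  have "f (d i) * W $ i $ j = W $ i $ j * f (e j)" for i j
    using entry[of i j] by (cases "W $ i $ j = 0") auto
  then have "diag_matrix (\<lambda>i. f (d i)) ** W = W ** diag_matrix (\<lambda>i. f (e i))"
    by (simp add: vec_eq_iff diag_matrix_mult_left diag_matrix_mult_right)
  then have *: "U ** (diag_matrix (\<lambda>i. f (d i)) ** W) ** transpose V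
      = U ** (W ** diag_matrix (\<lambda>i. f (e i))) ** transpose V"
    by simp
  have "U ** (diag_matrix (\<lambda>i. f (d i)) ** W) ** transpose V
      = U ** diag_matrix (\<lambda>i. f (d i)) ** transpose U ** (V ** transpose V)"
    unfolding W_def by (simp add: matrix_mul_assoc)
  moreover have "U ** (W ** diag_matrix (\<lambda>i. f (e i))) ** transpose V
      = (U ** transpose U) ** V ** diag_matrix (\<lambda>i. f (e i)) ** transpose V"
    unfolding W_def by (simp add: matrix_mul_assoc)
  ultimately show ?thesis using * by (simp add: U V)
qed

lemma matrix_fun_eq:
  assumes "orth_diagonalises U d A"
  shows "matrix_fun f A = U ** diag_matrix (\<lambda>i. f (d i)) ** transpose U"
  unfolding matrix_fun_def using assms matrix_fun_unique by (intro the_equality) blast+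

end

theory Submission imports Defs begin

text \<open>In an orthonormal eigenbasis \<open>U\<close> of \<open>A\<close> with eigenvalues \<open>d\<^sub>i\<close>, every diagonal entry
  \<open>(|A|\<^sup>s)\<^sub>j\<^sub>j\<close> is the moment \<open>\<Sum>\<^sub>i w\<^sub>i |d\<^sub>i|\<^sup>s\<close> of the spectral measure
  \<open>w\<^sub>i = (U\<^sub>j\<^sub>i)\<^sup>2\<close>, and the claim is Hoelder's inequality for
  \<open>|d|\<^sup>k\<^sup>-\<^sup>1 \<cdot> 1\<close> against the weights \<open>w\<^sub>i |d\<^sub>i|\<close>. The eigenbasis is obtained
  by maximising the Rayleigh quotient on successive invariant subspaces.\<close>

section \<open>The spectral theorem for symmetric matrices\<close>

text \<open>First-order condition at a minimum: near \<open>t = 0\<close> the linear term dominates,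
  so a nonzero \<open>b\<close> would force a negative value.\<close>

lemma quadratic_nonneg_imp_linear_zero:
  fixes b c :: real
  assumes "\<And>t. 0 \<le> 2 * t * b + t\<^sup>2 * c"
  shows "b = 0"
proof (rule ccontr)
  assume "b \<noteq> 0"
  \<comment> \<open>The sign is opposite to that of \<open>b\<close>, and the step is short enough
    that \<open>t\<^sup>2 * c\<close> cannot compensate; the \<open>+ 1\<close> covers
    \<open>c = 0\<close>.\<close>
  define t where "t = - b / (\<bar>c\<bar> + 1)"
  have b: "b = - t * (\<bar>c\<bar> + 1)"
    by (simp add: t_def)
  have "2 * t * b + t\<^sup>2 * c = 2 * t * (- t * (\<bar>c\<bar> + 1)) + t\<^sup>2 * c"
    by (simp only: flip: b)
  also have "\<dots> = t\<^sup>2 * (c - 2 * \<bar>c\<bar> - 2)"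
    by (simp add: power2_eq_square algebra_simps)
  finally have "2 * t * b + t\<^sup>2 * c = t\<^sup>2 * (c - 2 * \<bar>c\<bar> - 2)" .
  moreover have "t\<^sup>2 > 0"
    using \<open>b \<noteq> 0\<close> by (simp add: t_def)
  then have "t\<^sup>2 * (c - 2 * \<bar>c\<bar> - 2) < 0"
    by (intro mult_pos_neg) auto
  ultimately show False
    using assms[of t] by linarith
qed

text \<open>A maximiser \<open>v\<close> of \<open>x \<bullet> f x\<close> on the compact unit
  sphere of \<open>S\<close>, with maximum \<open>l\<close>, minimises the nonnegative form
  \<open>l * (x \<bullet> x) - x \<bullet> f x\<close> on \<open>S\<close>. Its gradient at
  \<open>v\<close>, a multiple of \<open>l *\<^sub>R v - f v\<close>, therefore vanishes along
  \<open>S\<close>.\<close>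

lemma selfadjoint_eigenvector_exists:
  fixes f :: "'a::euclidean_space \<Rightarrow> 'a"
  assumes "linear f" and sym: "\<And>x y. f x \<bullet> y = x \<bullet> f y"
    and S: "subspace S" and inv: "f ` S \<subseteq> S" and "S \<noteq> {0}"
  obtains v l where "v \<in> S" "norm v = 1" "f v = l *\<^sub>R v"
proof -
  interpret linear f by fact
  let ?K = "S \<inter> sphere 0 1"
  obtain s where "s \<in> S" "s \<noteq> 0"
    using S \<open>S \<noteq> {0}\<close> subspace_0 by blast
  then have "s /\<^sub>R norm s \<in> ?K"
    using S by (simp add: subspace_scale)
  moreover have "compact ?K"
    using closed_subspace[OF S] by (simp add: closed_Int_compact)
  moreover have "continuous_on ?K (\<lambda>x. x \<bullet> f x)"
    using \<open>linear f\<close> by (intro continuous_intros linear_continuous_on linear_conv_bounded_linear[THEN iffD1])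
  ultimately obtain v where v: "v \<in> ?K" and max: "\<And>y. y \<in> ?K \<Longrightarrow> y \<bullet> f y \<le> v \<bullet> f v"
    using continuous_attains_sup[of ?K "\<lambda>x. x \<bullet> f x"] by blast
  define l where "l = v \<bullet> f v"
  have vv: "v \<in> S" "norm v = 1" "v \<bullet> v = 1"
    using v by (auto simp: dot_square_norm)
  \<comment> \<open>Both sides scale quadratically, so the maximum on the sphere controls all of
    \<open>S\<close>.\<close>
  have bound: "y \<bullet> f y \<le> l * (y \<bullet> y)" if "y \<in> S" for y
  proof (cases "y = 0")
    case False
    then have "y /\<^sub>R norm y \<in> ?K"
      using S that by (simp add: subspace_scale)
    from max[OF this] have "(y \<bullet> f y) / (norm y)\<^sup>2 \<le> l"
      by (simp add: scale l_def power2_eq_square divide_inverse mult_ac)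
    with False show ?thesis
      by (simp add: divide_le_eq dot_square_norm)
  qed simp
  \<comment> \<open>Perturb \<open>v\<close> to \<open>v + t *\<^sub>R y\<close>: the constant term
    cancels because \<open>v \<bullet> f v = l\<close> and \<open>v \<bullet> v = 1\<close>.\<close>
  have orth: "(l *\<^sub>R v - f v) \<bullet> y = 0" if "y \<in> S" for y
  proof (rule quadratic_nonneg_imp_linear_zero)
    fix t :: real
    have "v + t *\<^sub>R y \<in> S"
      using S vv that by (simp add: subspace_add subspace_scale)
    from bound[OF this] have "0 \<le> l * ((v + t *\<^sub>R y) \<bullet> (v + t *\<^sub>R y)) - (v + t *\<^sub>R y) \<bullet> f (v + t *\<^sub>R y)"
      by simp
    also have "\<dots> = 2 * t * ((l *\<^sub>R v - f v) \<bullet> y) + t\<^sup>2 * (l * (y \<bullet> y) - y \<bullet> f y)"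
      using vv sym[of v y] sym[of y v]
      by (simp add: add scale inner_add inner_diff inner_commute l_def[symmetric] power2_eq_square algebra_simps)
    finally show "0 \<le> \<dots>" .
  qed
  \<comment> \<open>By invariance the residual itself is an admissible test vector, hence orthogonal
    to itself.\<close>
  have "l *\<^sub>R v - f v \<in> S"
    using S vv inv by (auto intro!: subspace_diff subspace_scale)
  from orth[OF this] have "f v = l *\<^sub>R v"
    by simp
  then show thesis
    using that vv by blast
qed

text \<open>Induction on the dimension: split off one unit eigenvector and continue in its
  orthogonal complement within \<open>S\<close>.\<close>

lemma selfadjoint_orthonormal_eigenbasis:
  fixes f :: "'a::euclidean_space \<Rightarrow> 'a"
  assumes "linear f" and sym: "\<And>x y. f x \<bullet> y = x \<bullet> f y"
    and "subspace S" and "f ` S \<subseteq> S"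
  shows "\<exists>B\<subseteq>S. finite B \<and> card B = dim S \<and> pairwise orthogonal B \<and>
           (\<forall>b\<in>B. norm b = 1 \<and> (\<exists>l. f b = l *\<^sub>R b))"
  using assms(3,4)
proof (induction "dim S" arbitrary: S)
  case 0
  then show ?case
    by (intro exI[of _ "{}"]) auto
next
  case (Suc n)
  have "S \<noteq> {0}"
    using Suc.hyps(2) by auto
  then obtain v l where v: "v \<in> S" "norm v = 1" "f v = l *\<^sub>R v"
    using selfadjoint_eigenvector_exists[OF \<open>linear f\<close> sym Suc.prems] by blast
  \<comment> \<open>Phrased with \<open>span {v}\<close> to match the dimension formula for
    orthogonal complements.\<close>
  define T where "T = {y \<in> S. \<forall>x \<in> span {v}. orthogonal x y}"
  have T: "T = {y \<in> S. v \<bullet> y = 0}"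
    by (auto simp: T_def span_singleton orthogonal_def)
  have "subspace T"
    using Suc.prems(1) by (auto simp: T subspace_def inner_add)
  have "dim (span {v}) = 1"
    using v by (simp add: dim_singleton) auto
  moreover have "dim T + dim (span {v}) = dim S"
    unfolding T_def using v Suc.prems by (intro dim_subspace_orthogonal_to_vectors) (auto simp: span_minimal)
  ultimately have dT: "dim S = Suc (dim T)" by simp
  \<comment> \<open>For \<open>y\<close> in \<open>T\<close>, self-adjointness gives
    \<open>v \<bullet> f y = f v \<bullet> y = l * (v \<bullet> y) = 0\<close>.\<close>
  have "f ` T \<subseteq> T"
    using Suc.prems(2) v by (auto simp: T simp flip: sym)
  then obtain B where B: "B \<subseteq> T" "finite B" "card B = dim T" "pairwise orthogonal B"
      "\<forall>b\<in>B. norm b = 1 \<and> (\<exists>l. f b = l *\<^sub>R b)"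
    using Suc.hyps(1)[of T] \<open>subspace T\<close> dT Suc.hyps(2) by auto
  have "v \<notin> B"
    using B(1) v by (auto simp: T)
  moreover have "pairwise orthogonal (insert v B)"
    using B by (auto simp: T pairwise_insert orthogonal_def inner_commute)
  ultimately show ?case
    using B v dT T by (intro exI[of _ "insert v B"]) auto
qed

theorem symmetric_matrix_orth_diagonalisable:
  fixes A :: "real^'n::finite^'n"
  assumes "transpose A = A"
  obtains U d where "orth_diagonalises U d A"
proof -
  have "(A *v x) \<bullet> y = x \<bullet> (A *v y)" for x y
    by (metis assms dot_lmul_matrix transpose_matrix_vector)
  then obtain B :: "(real^'n) set" where B: "finite B" "card B = CARD('n)" "pairwise orthogonal B"
      "\<And>b. b \<in> B \<Longrightarrow> norm b = 1" "\<And>b. b \<in> B \<Longrightarrow> \<exists>l. A *v b = l *\<^sub>R b"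
    using selfadjoint_orthonormal_eigenbasis[of "(*v) A" UNIV] by (auto simp: subspace_UNIV)
  \<comment> \<open>The cardinalities agree, so the eigenbasis can be indexed by \<open>'n\<close>
    and form the columns of \<open>U\<close>.\<close>
  obtain b where b: "bij_betw b (UNIV :: 'n set) B"
    using B(1,2) finite_same_card_bij[of "UNIV :: 'n set" B] by auto
  then have bB: "b i \<in> B" and inj: "b i = b j \<longleftrightarrow> i = j" for i j
    by (auto simp: bij_betw_def inj_def)
  obtain d where d: "\<And>i. A *v b i = d i *\<^sub>R b i"
    using B(5)[OF bB] by metis
  define U :: "real^'n^'n" where "U = (\<chi> i j. b j $ i)"
  have col: "column j U = b j" for j
    by (simp add: column_def U_def vec_eq_iff)
  have U: "orthogonal_matrix U"
    unfolding orthogonal_matrix_orthonormal_columns col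
    using B(3,4) bB inj by (auto simp: pairwise_def)
  have "A ** U = U ** diag_matrix d"
  proof -
    have "(A ** U) $ i $ j = (A *v b j) $ i" for i j
      by (simp add: matrix_matrix_mult_def matrix_vector_mult_def U_def)
    then show ?thesis
      by (simp add: vec_eq_iff diag_matrix_mult_right d U_def)
  qed
  then have "U ** diag_matrix d ** transpose U = A ** (U ** transpose U)"
    by (simp add: matrix_mul_assoc)
  also have "\<dots> = A"
    using U by (simp add: orthogonal_matrix_def)
  finally show thesis
    using U that[of U d] by (simp add: orth_diagonalises_def)
qed

section \<open>Diagonal entries as spectral moments\<close>

lemma diag_entry_conjugate_diag:
  "diag_entry j (U ** diag_matrix d ** transpose U) = (\<Sum>i\<in>UNIV. (U $ j $ i)\<^sup>2 * d i)"
proof -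
  have "diag_entry j (U ** diag_matrix d ** transpose U)
      = (\<Sum>i\<in>UNIV. (U ** diag_matrix d) $ j $ i * U $ j $ i)"
    unfolding diag_entry_def
    by (subst (1) matrix_matrix_mult_def) (simp add: transpose_def)
  then show ?thesis
    by (simp add: diag_matrix_mult_right power2_eq_square mult_ac)
qed

text \<open>\<open>matrix_abs\<close> applies \<open>sqrt\<close> to
  \<open>A ** transpose A\<close>; sharing \<open>U\<close> with \<open>A\<close> lets the energy
  and the powers of |A| be expanded with the same weights.\<close>

lemma orth_diagonalises_mult_transpose:
  assumes "orth_diagonalises U d A"
  shows "orth_diagonalises U (\<lambda>i. (d i)\<^sup>2) (A ** transpose A)"
proof -
  have U: "orthogonal_matrix U" "transpose U ** U = mat 1"
    and A: "A = U ** diag_matrix d ** transpose U"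
    using assms by (auto simp: orth_diagonalises_def orthogonal_matrix_def)
  have sym: "transpose (diag_matrix d) = diag_matrix d"
    by (simp add: vec_eq_iff transpose_def diag_matrix_def)
  have sq: "diag_matrix d ** diag_matrix d = diag_matrix (\<lambda>i. (d i)\<^sup>2)"
    by (simp add: vec_eq_iff diag_matrix_mult_left) (simp add: diag_matrix_def power2_eq_square)
  have "A ** transpose A
      = U ** diag_matrix d ** (transpose U ** U) ** diag_matrix d ** transpose U"
    by (simp add: A matrix_transpose_mul sym matrix_mul_assoc)
  also have "\<dots> = U ** (diag_matrix d ** diag_matrix d) ** transpose U"
    by (simp add: U matrix_mul_assoc)
  finally show ?thesis
    using U by (simp add: sq orth_diagonalises_def)
qed

lemma diag_entry_matrix_abs:
  assumes "orth_diagonalises U d A"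
  shows "diag_entry j (matrix_abs A) = (\<Sum>i\<in>UNIV. (U $ j $ i)\<^sup>2 * \<bar>d i\<bar>)"
  by (simp add: matrix_abs_def matrix_fun_eq[OF orth_diagonalises_mult_transpose[OF assms]]
      diag_entry_conjugate_diag)

lemma diag_entry_matrix_abs_powr:
  assumes "orth_diagonalises U d A"
  shows "diag_entry j (matrix_abs_powr A s) = (\<Sum>i\<in>UNIV. (U $ j $ i)\<^sup>2 * \<bar>d i\<bar> powr s)"
  by (simp add: matrix_abs_powr_def matrix_fun_eq[OF assms] diag_entry_conjugate_diag)

lemma transpose_adj_matrix:
  "simple_graph E \<Longrightarrow> transpose (adj_matrix E) = adj_matrix E"
  by (auto simp: vec_eq_iff transpose_def adj_matrix_def simple_graph_def symp_def)

section \<open>Hoelder's inequality for finite weighted sums\<close>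

text \<open>Normalise by \<open>?T\<close> and \<open>?S\<close>, apply Young's inequality termwise,
  and sum against \<open>c\<close>: the right-hand sides add up to 1/p + 1/q = 1.\<close>

lemma weighted_Holder_sum:
  fixes c y :: "'a \<Rightarrow> real" and p q :: real
  assumes "finite I" and c: "\<And>i. i \<in> I \<Longrightarrow> 0 \<le> c i" and y: "\<And>i. i \<in> I \<Longrightarrow> 0 \<le> y i"
    and p: "0 < p" and q: "0 < q" and pq: "1 / p + 1 / q = 1"
  shows "(\<Sum>i\<in>I. c i * y i) \<le> (\<Sum>i\<in>I. c i * y i powr p) powr (1/p) * (\<Sum>i\<in>I. c i) powr (1/q)"
    (is "?R \<le> ?T powr _ * ?S powr _")
proof (cases "?T = 0")
  \<comment> \<open>Normalising by \<open>?T\<close> is impossible here, but every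
    \<open>c i * y i\<close> vanishes.\<close>
  case True
  then have "\<forall>i\<in>I. c i * y i powr p = 0"
    using assms by (subst (asm) sum_nonneg_eq_0_iff) auto
  then have "?R = 0"
    by (intro sum.neutral) auto
  then show ?thesis by simp
next
  case False
  have "?T \<ge> 0" "?S \<ge> 0"
    using c by (auto intro!: sum_nonneg)
  have "?S \<noteq> 0"
    using False \<open>finite I\<close> c sum_nonneg_eq_0_iff[of I c] by (metis (no_types, lifting) mult_zero_left sum.neutral)
  with False \<open>?T \<ge> 0\<close> \<open>?S \<ge> 0\<close> have pos: "?T > 0" "?S > 0" by auto
  let ?N = "?T powr (1/p) * ?S powr (1/q)"
  have "?N > 0" using pos by simp
  \<comment> \<open>Young's inequality for \<open>y i powr p / ?T\<close> and \<open>1 / ?S\<close>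
    with exponents 1/p and 1/q; it is applied to positive numbers, so \<open>y i = 0\<close> is
    treated apart.\<close>
  have "y i / ?N \<le> (1/p) * (y i powr p / ?T) + (1/q) * (1 / ?S)" if "i \<in> I" for i
  proof (cases "y i = 0")
    case True
    then show ?thesis using p q pos by simp
  next
    case False
    with y that have "y i > 0" by (simp add: order_less_le)
    have "(y i powr p / ?T) powr (1/p) * (1 / ?S) powr (1/q) = y i / ?N"
      using \<open>y i > 0\<close> pos p by (simp add: powr_divide powr_powr)
    moreover have "(y i powr p / ?T) powr (1/p) * (1 / ?S) powr (1/q)
        \<le> (1/p) * (y i powr p / ?T) + (1/q) * (1 / ?S)"
      using \<open>y i > 0\<close> pos p q pq by (intro Youngs_inequality_0) auto
    ultimately show ?thesis by simp
  qed
  then have "(\<Sum>i\<in>I. c i * (y i / ?N))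
      \<le> (\<Sum>i\<in>I. c i * ((1/p) * (y i powr p / ?T) + (1/q) * (1 / ?S)))"
    using c by (intro sum_mono mult_left_mono) auto
  also have "\<dots> = (\<Sum>i\<in>I. 1 / (p * ?T) * (c i * y i powr p) + 1 / (q * ?S) * c i)"
    by (intro sum.cong) (auto simp: distrib_left)
  also have "\<dots> = 1 / (p * ?T) * ?T + 1 / (q * ?S) * ?S"
    by (simp only: sum.distrib sum_distrib_left)
  also have "\<dots> = 1"
    using pos pq by simp
  finally have "?R / ?N \<le> 1"
    by (simp add: sum_divide_distrib)
  then show ?thesis
    using \<open>?N > 0\<close> by (simp add: divide_le_eq)
qed

theorem theorem3p4:
  fixes E :: "'n::finite \<Rightarrow> 'n \<Rightarrow> bool" and k p q :: real
  assumes "simple_graph E"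
    and "\<exists>u v. E u v"
    and "k \<ge> 2"
    and "0 < p" and "0 < q" and "1 / p + 1 / q = 1"
  shows "\<forall>j. (diag_entry j (matrix_abs_powr (adj_matrix E) k)) powr q
           / (diag_entry j (matrix_abs_powr (adj_matrix E) (p * (k - 1) + 1))) powr (q / p)
         \<le> vertex_energy E j"
proof
  fix j
  obtain U d where Ud: "orth_diagonalises U d (adj_matrix E)"
    using symmetric_matrix_orth_diagonalisable transpose_adj_matrix[OF assms(1)] by blast
  \<comment> \<open>Moving one factor \<open>\<bar>d i\<bar>\<close> into the weight makes the total
    mass the vertex energy and accounts for the \<open>+ 1\<close> in the exponent
    \<open>p * (k - 1) + 1\<close>.\<close>
  define c where "c i = (U $ j $ i)\<^sup>2 * \<bar>d i\<bar>" for i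
  define y where "y i = \<bar>d i\<bar> powr (k - 1)" for i
  let ?R = "\<Sum>i\<in>UNIV. c i * y i" and ?T = "\<Sum>i\<in>UNIV. c i * y i powr p" and ?S = "\<Sum>i\<in>UNIV. c i"
  \<comment> \<open>At \<open>x = 0\<close> both sides are 0, since \<open>0 powr s = 0\<close> for
    every \<open>s\<close>.\<close>
  have split: "\<bar>x\<bar> powr (s + 1) = \<bar>x\<bar> * \<bar>x\<bar> powr s" for x s :: real
    by (cases "x = 0") (auto simp: powr_add)
  have R: "diag_entry j (matrix_abs_powr (adj_matrix E) k) = ?R"
    using split[of _ "k - 1"] by (simp add: diag_entry_matrix_abs_powr[OF Ud] c_def y_def mult_ac)
  have T: "diag_entry j (matrix_abs_powr (adj_matrix E) (p * (k - 1) + 1)) = ?T"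
    by (simp add: diag_entry_matrix_abs_powr[OF Ud] c_def y_def split powr_powr mult_ac)
  have S: "vertex_energy E j = ?S"
    by (simp add: vertex_energy_def diag_entry_matrix_abs[OF Ud] c_def)
  have nonneg: "0 \<le> c i" "0 \<le> y i" for i
    by (simp_all add: c_def y_def)
  then have "0 \<le> ?R" "0 \<le> ?S" "0 \<le> ?T"
    by (auto intro!: sum_nonneg)
  \<comment> \<open>Raising to the power \<open>q\<close> turns the factor
    \<open>?S powr (1/q)\<close> into \<open>?S\<close>.\<close>
  then have "?R powr q \<le> (?T powr (1/p) * ?S powr (1/q)) powr q"
    using nonneg assms by (intro powr_mono2 weighted_Holder_sum) auto
  also have "\<dots> = ?S * ?T powr (q / p)"
    using \<open>0 \<le> ?S\<close> \<open>0 < q\<close> by (simp add: powr_mult powr_powr)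
  \<comment> \<open>If \<open>?T = 0\<close>, division by zero makes the quotient 0, and
    \<open>?S\<close> is nonnegative.\<close>
  finally have "?R powr q / ?T powr (q / p) \<le> ?S"
    using \<open>0 \<le> ?S\<close> by (cases "?T = 0") (auto simp: divide_le_eq)
  then show "(diag_entry j (matrix_abs_powr (adj_matrix E) k)) powr q
           / (diag_entry j (matrix_abs_powr (adj_matrix E) (p * (k - 1) + 1))) powr (q / p)
         \<le> vertex_energy E j"
    by (simp only: R T S)
qed

end
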